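(* Let $G$ be a locally precompact group, with completion $\widetilde G$, and consider the following statements: (i) $G$ is connected; (ii) $G$ has no proper open subgroups; (iii) $\widetilde G$ is connected. Then (i) $\Rightarrow$ (ii) $\Leftrightarrow$ (iii). Furthermore, if $G$ is locally pseudocompact, then all three conditions are equivalent.
   Context: All topological spaces and topological groups are assumed to be Tychonoff (in particular Hausdorff); groups need not be abelian. $\mathcal{N}(G)$ is the collection of open neighborhoods of the identity of $G$. A subset $X$ of a topological group $G$ is precompact if for every $U\in\mathcal{N}(G)$ there is a finite $S\subseteq X$ with $X\subseteq (SU)\cap(US)$. $G$ is locally precompact if some non-empty open subset of $G$ is precompact; by Weil's theorem, this holds if and only if $G$ embeds as a dense topological subgroup of a locally compact group $\widetilde G$, which is then unique up to topological isomorphism fixing $G$ and is called the completion of $G$. A space is pseudocompact if every continuous real-valued function on it is bounded. $G$ is locally pseudocompact if there is $U\in\mathcal{N}(G)$ such that $\operatorname{cl}_G U$ is pseudocompact. *)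

theory Defs
  imports "HOL-Algebra.Coset" "HOL-Analysis.Analysis"
begin

text \<open>
  A group in the sense of HOL-Algebra (not necessarily abelian) together with a Tychonoff
  topology on its carrier. Since \<^const>\<open>completely_regular_space\<close> does not include any
  separation of points, the Hausdorff axiom is listed separately.
\<close>

locale topological_group = group G for G (structure) +
  fixes T :: "'a topology"
  assumes topspace_eq: "topspace T = carrier G"
    and continuous_mult: "continuous_map (prod_topology T T) T (\<lambda>(x, y). x \<otimes> y)"
    and continuous_inv: "continuous_map T T (\<lambda>x. inv x)"
    and Hausdorff: "Hausdorff_space T"
    and completely_regular: "completely_regular_space T"

definition identity_nhds :: "('a, 'm) monoid_scheme \<Rightarrow> 'a topology \<Rightarrow> 'a set set" where
  "identity_nhds G T = {U. openin T U \<and> \<one>\<^bsub>G\<^esub> \<in> U}"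

definition precompact_in :: "('a, 'm) monoid_scheme \<Rightarrow> 'a topology \<Rightarrow> 'a set \<Rightarrow> bool" where
  "precompact_in G T X \<longleftrightarrow> X \<subseteq> carrier G \<and>
     (\<forall>U \<in> identity_nhds G T. \<exists>S. finite S \<and> S \<subseteq> X \<and> X \<subseteq> (S <#>\<^bsub>G\<^esub> U) \<inter> (U <#>\<^bsub>G\<^esub> S))"

definition locally_precompact :: "('a, 'm) monoid_scheme \<Rightarrow> 'a topology \<Rightarrow> bool" where
  "locally_precompact G T \<longleftrightarrow> (\<exists>V. openin T V \<and> V \<noteq> {} \<and> precompact_in G T V)"

text \<open>
  The completion is determined only up to topological isomorphism, so it is described by a
  predicate: \<open>(Gt, Tt)\<close> is a locally compact group in which \<open>(G, T)\<close> is a dense topological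
  subgroup by means of the embedding \<open>e\<close>.
\<close>

definition is_completion ::
  "('a, 'm) monoid_scheme \<Rightarrow> 'a topology \<Rightarrow> ('b, 'n) monoid_scheme \<Rightarrow> 'b topology \<Rightarrow> ('a \<Rightarrow> 'b) \<Rightarrow> bool"
where
  "is_completion G T Gt Tt e \<longleftrightarrow>
     topological_group Gt Tt \<and> locally_compact_space Tt \<and>
     e \<in> hom G Gt \<and> embedding_map T Tt e \<and> Tt closure_of (e ` carrier G) = carrier Gt"

definition pseudocompact_space :: "'a topology \<Rightarrow> bool" where
  "pseudocompact_space X \<longleftrightarrow>
     (\<forall>f :: 'a \<Rightarrow> real. continuous_map X euclideanreal f \<longrightarrow> bounded (f ` topspace X))"

definition locally_pseudocompact :: "('a, 'm) monoid_scheme \<Rightarrow> 'a topology \<Rightarrow> bool" where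
  "locally_pseudocompact G T \<longleftrightarrow>
     (\<exists>U \<in> identity_nhds G T. pseudocompact_space (subtopology T (T closure_of U)))"

definition no_proper_open_subgroup :: "('a, 'm) monoid_scheme \<Rightarrow> 'a topology \<Rightarrow> bool" where
  "no_proper_open_subgroup G T \<longleftrightarrow> (\<forall>H. subgroup H G \<and> openin T H \<longrightarrow> H = carrier G)"

end

theory Submission
  imports Defs
begin

text \<open>
  An open subgroup of the completion \<open>K\<close> contains a dense set as soon as its trace on \<open>G\<close> is all of
  \<open>G\<close>, and open subgroups are closed, so \<open>K\<close> inherits the absence of proper open subgroups. If \<open>K\<close> is
  disconnected, its space of components is Hausdorff, locally compact, and has a trivial component
  at the identity, hence a compact open neighbourhood of that point avoiding another given one; the
  stabiliser of its preimage under left translation is a proper open subgroup of \<open>K\<close>. Conversely, a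
  proper open subgroup \<open>H\<close> of \<open>G\<close> and its complement have disjoint closures in \<open>K\<close>, which therefore is
  disconnected.

  Now let \<open>G\<close> be locally pseudocompact with a partition into two nonempty open sets, the traces of
  disjoint open sets \<open>A\<close>, \<open>B\<close> of \<open>K\<close>. If \<open>K\<close> is connected, the closures of \<open>A\<close> and \<open>B\<close> share a point \<open>x\<close>.
  Near \<open>x\<close> one finds decreasing compact neighbourhoods \<open>K\<^sub>n\<close> of the identity, \<open>v\<^sub>n \<in> K\<^sub>n\<close> and nonempty
  open sets \<open>Y\<^sub>n \<subseteq> A\<close> such that \<open>k\<^sup>-\<^sup>1 v\<^sub>n Y\<^sub>n \<subseteq> B\<close> for all \<open>k \<in> K\<^sub>n\<^sub>+\<^sub>1\<close>. By pseudocompactness the \<open>Y\<^sub>n\<close>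
  accumulate at some \<open>y \<in> G\<close>, and \<open>y \<in> A\<close>. By compactness \<open>v\<^sub>n\<close> is eventually close to some
  \<open>u \<in> \<Inter>\<^sub>n K\<^sub>n\<close>, so \<open>u\<^sup>-\<^sup>1 v\<^sub>n Y\<^sub>n \<subseteq> B\<close> comes arbitrarily close to \<open>y\<close> as well, which is absurd.
\<close>

section \<open>Topological groups\<close>

context topological_group
begin

lemma openin_carrier: "openin T U \<Longrightarrow> U \<subseteq> carrier G"
  using openin_subset topspace_eq by blast

lemma mult_nhds:
  assumes "openin T W" "a \<otimes> b \<in> W" "a \<in> carrier G" "b \<in> carrier G"
  obtains U V where "openin T U" "openin T V" "a \<in> U" "b \<in> V"
    "\<And>u v. u \<in> U \<Longrightarrow> v \<in> V \<Longrightarrow> u \<otimes> v \<in> W"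
proof -
  let ?P = "{z \<in> topspace (prod_topology T T). (\<lambda>(x, y). x \<otimes> y) z \<in> W}"
  have "openin (prod_topology T T) ?P"
    using continuous_mult assms(1) by (rule openin_continuous_map_preimage)
  moreover have "(a, b) \<in> ?P"
    using assms by (simp add: topspace_eq)
  ultimately have "\<exists>U V. openin T U \<and> openin T V \<and> a \<in> U \<and> b \<in> V \<and> U \<times> V \<subseteq> ?P"
    using openin_prod_topology_alt[of T T ?P] by (meson rev_iffD1)
  then obtain U V where "openin T U" "openin T V" "a \<in> U" "b \<in> V" "U \<times> V \<subseteq> ?P"
    by blast
  moreover have "u \<otimes> v \<in> W" if "u \<in> U" "v \<in> V" for u v
    using subsetD[OF \<open>U \<times> V \<subseteq> ?P\<close>, of "(u, v)"] that by simp
  ultimately show thesis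
    by (intro that[of U V]) simp_all
qed

lemma inv_nhds:
  assumes "openin T W"
  shows "openin T {x \<in> carrier G. inv x \<in> W}"
  using openin_continuous_map_preimage[OF continuous_inv assms] by (simp add: topspace_eq)

lemma inv_mult_nhds:
  assumes "openin T W" "inv a \<otimes> b \<in> W" "a \<in> carrier G" "b \<in> carrier G"
  obtains U V where "openin T U" "openin T V" "a \<in> U" "b \<in> V"
    "\<And>u v. u \<in> U \<Longrightarrow> v \<in> V \<Longrightarrow> inv u \<otimes> v \<in> W"
proof -
  obtain U V where "openin T U" "openin T V" "inv a \<in> U" "b \<in> V"
    "\<And>u v. u \<in> U \<Longrightarrow> v \<in> V \<Longrightarrow> u \<otimes> v \<in> W"
    using mult_nhds[OF assms(1,2)] assms by (metis inv_closed)
  with assms inv_nhds[of U] show thesis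
    by (intro that[of "{x \<in> carrier G. inv x \<in> U}" V]) auto
qed

lemma mult_inv_nhds:
  assumes "openin T W" "a \<otimes> inv b \<in> W" "a \<in> carrier G" "b \<in> carrier G"
  obtains U V where "openin T U" "openin T V" "a \<in> U" "b \<in> V"
    "\<And>u v. u \<in> U \<Longrightarrow> v \<in> V \<Longrightarrow> u \<otimes> inv v \<in> W"
proof -
  obtain U V where "openin T U" "openin T V" "a \<in> U" "inv b \<in> V"
    "\<And>u v. u \<in> U \<Longrightarrow> v \<in> V \<Longrightarrow> u \<otimes> v \<in> W"
    using mult_nhds[OF assms(1,2)] assms by (metis inv_closed)
  with assms inv_nhds[of V] show thesis
    by (intro that[of U "{x \<in> carrier G. inv x \<in> V}"]) auto
qed

lemma continuous_map_left_translation: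
  assumes "a \<in> carrier G"
  shows "continuous_map T T (\<lambda>x. a \<otimes> x)"
proof -
  have "continuous_map T (prod_topology T T) (\<lambda>x. (a, x))"
    using assms by (auto intro!: continuous_map_pairedI simp: topspace_eq)
  from continuous_map_compose[OF this continuous_mult] show ?thesis
    by (simp add: comp_def)
qed

lemma continuous_map_right_translation:
  assumes "a \<in> carrier G"
  shows "continuous_map T T (\<lambda>x. x \<otimes> a)"
proof -
  have "continuous_map T (prod_topology T T) (\<lambda>x. (x, a))"
    using assms by (auto intro!: continuous_map_pairedI simp: topspace_eq)
  from continuous_map_compose[OF this continuous_mult] show ?thesis
    by (simp add: comp_def)
qed

lemma openin_left_preimage:
  assumes "a \<in> carrier G" "openin T U"
  shows "openin T {x \<in> carrier G. a \<otimes> x \<in> U}"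
  using openin_continuous_map_preimage[OF continuous_map_left_translation[OF assms(1)] assms(2)]
  by (simp add: topspace_eq)

lemma openin_right_preimage:
  assumes "a \<in> carrier G" "openin T U"
  shows "openin T {x \<in> carrier G. x \<otimes> a \<in> U}"
  using openin_continuous_map_preimage[OF continuous_map_right_translation[OF assms(1)] assms(2)]
  by (simp add: topspace_eq)

text \<open>The product is a union of left translates of \<open>U\<close>. \<open>N\<close> stays
  arbitrary: it will be a subgroup, the complement of one, or an intersection of compact
  sets.\<close>

lemma openin_set_mult:
  assumes N: "N \<subseteq> carrier G" and U: "openin T U"
  shows "openin T (N <#> U)"
proof -
  have "N <#> U = (\<Union>a\<in>N. {x \<in> carrier G. inv a \<otimes> x \<in> U})"
    using N openin_carrier[OF U] unfolding set_mult_def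
    by (fastforce simp: m_assoc[symmetric] inv_solve_left')
  moreover have "openin T (\<Union>a\<in>N. {x \<in> carrier G. inv a \<otimes> x \<in> U})"
    using N openin_left_preimage[OF _ U] by (auto intro!: openin_Union)
  ultimately show ?thesis
    by simp
qed

lemma connected_component_of_left_translation:
  assumes "connected_component_of T x y" "a \<in> carrier G"
  shows "connected_component_of T (a \<otimes> x) (a \<otimes> y)"
proof -
  obtain S where "connectedin T S" "x \<in> S" "y \<in> S"
    using assms(1) unfolding connected_component_of_def by blast
  then show ?thesis
    using connectedin_continuous_map_image[OF continuous_map_left_translation[OF assms(2)]]
    unfolding connected_component_of_def by blast
qed

lemma openin_subgroupI:
  assumes H: "subgroup H G" and V: "openin T V" "\<one> \<in> V" "V \<subseteq> H"
  shows "openin T H"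
proof -
  have "H <#> V = H"
  proof
    show "H <#> V \<subseteq> H"
      using V(3) subgroup.m_closed[OF H] unfolding set_mult_def by blast
    show "H \<subseteq> H <#> V"
      using V(2) subgroup.subset[OF H] unfolding set_mult_def by force
  qed
  then show ?thesis
    using openin_set_mult[OF subgroup.subset[OF H] V(1)] by simp
qed

end


section \<open>Locally compact groups without proper open subgroups\<close>

definition component_map :: "'a topology \<Rightarrow> 'a \<Rightarrow> 'a set" where
  "component_map X x = connected_component_of_set X x"

text \<open>The quotient topology of \<open>component_map\<close>. For a topological group its
  points are the left cosets of the identity component.\<close>

definition component_space :: "'a topology \<Rightarrow> 'a set topology" where
  "component_space X = topology (\<lambda>U. U \<subseteq> component_map X ` topspace X \<and>
     openin X {x \<in> topspace X. component_map X x \<in> U})"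

lemma openin_component_space:
  "openin (component_space X) U \<longleftrightarrow> U \<subseteq> component_map X ` topspace X \<and>
     openin X {x \<in> topspace X. component_map X x \<in> U}"
proof -
  let ?L = "\<lambda>U. U \<subseteq> component_map X ` topspace X \<and> openin X {x \<in> topspace X. component_map X x \<in> U}"
  have "istopology ?L"
    unfolding istopology_def
  proof (intro conjI allI impI)
    fix S S' assume "?L S" "?L S'"
    then have "openin X ({x \<in> topspace X. component_map X x \<in> S} \<inter> {x \<in> topspace X. component_map X x \<in> S'})"
      by (intro openin_Int) simp_all
    moreover have "{x \<in> topspace X. component_map X x \<in> S \<inter> S'} =
        {x \<in> topspace X. component_map X x \<in> S} \<inter> {x \<in> topspace X. component_map X x \<in> S'}"
      by auto
    ultimately show "openin X {x \<in> topspace X. component_map X x \<in> S \<inter> S'}"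
      by simp
  next
    fix K assume K: "\<forall>S\<in>K. ?L S"
    have "{x \<in> topspace X. component_map X x \<in> \<Union>K} =
        (\<Union>S\<in>K. {x \<in> topspace X. component_map X x \<in> S})"
      by auto
    then show "openin X {x \<in> topspace X. component_map X x \<in> \<Union>K}"
      using K by auto
  qed blast+
  then show ?thesis
    unfolding component_space_def by simp
qed

lemma topspace_component_space [simp]:
  "topspace (component_space X) = component_map X ` topspace X"
proof
  have "{x \<in> topspace X. component_map X x \<in> component_map X ` topspace X} = topspace X"
    by auto
  then have "openin (component_space X) (component_map X ` topspace X)"
    by (simp add: openin_component_space)
  then show "component_map X ` topspace X \<subseteq> topspace (component_space X)"
    by (rule openin_subset)
  show "topspace (component_space X) \<subseteq> component_map X ` topspace X"
    using openin_component_space openin_topspace by blast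
qed

lemma continuous_map_component_map: "continuous_map X (component_space X) (component_map X)"
  by (auto simp: continuous_map_def openin_component_space)

lemma component_map_eq_iff:
  assumes "x \<in> topspace X" "y \<in> topspace X"
  shows "component_map X x = component_map X y \<longleftrightarrow> connected_component_of X x y"
  using assms unfolding component_map_def
  by (metis connected_component_of_eq connected_component_of_refl mem_Collect_eq
      connected_component_of_equiv)

text \<open>Fibres are components. Together with openness of the map this makes preimages of
  connected sets connected.\<close>

lemma monotone_map_component_map: "monotone_map X (component_space X) (component_map X)"
  unfolding monotone_map_def
proof (intro conjI ballI)
  fix C assume "C \<in> topspace (component_space X)"
  then obtain y where y: "y \<in> topspace X" "C = component_map X y"
    by auto
  have "x \<in> topspace X \<and> component_map X x = C \<longleftrightarrow> connected_component_of X y x" for x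
    using y component_map_eq_iff[of y X x] connected_component_of_equiv[of X y x] by auto
  then have "{x \<in> topspace X. component_map X x = C} = connected_component_of_set X y"
    by blast
  then show "connectedin X {x \<in> topspace X. component_map X x = C}"
    by (simp add: connectedin_connected_component_of)
qed simp

section \<open>Components of a topological group\<close>

context topological_group
begin

text \<open>If \<open>x\<close> and \<open>u\<close> lie in the same component, then so do \<open>u'\<close> and \<open>u' u\<^sup>-\<^sup>1 x\<close>, so the saturation of
  an open set is a union of right translates of it.\<close>

lemma open_map_component_map: "open_map T (component_space T) (component_map T)"
  unfolding open_map_def
proof (intro allI impI)
  fix U assume U: "openin T U"
  let ?S = "{x \<in> topspace T. component_map T x \<in> component_map T ` U}"
  have "openin T ?S"
    unfolding openin_subopen[of T ?S]
  proof
    fix x assume "x \<in> ?S"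
    then obtain u where x: "x \<in> carrier G" and u: "u \<in> U" "u \<in> carrier G"
      and ux: "connected_component_of T u x"
      using openin_carrier[OF U] topspace_eq
      by (auto simp: component_map_eq_iff connected_component_of_sym subset_eq)
    define M where "M = {z \<in> carrier G. z \<otimes> (inv x \<otimes> u) \<in> U}"
    have "openin T M"
      unfolding M_def using x u U by (intro openin_right_preimage) auto
    moreover have "x \<in> M"
      using x u by (simp add: M_def m_assoc[symmetric])
    moreover have "M \<subseteq> ?S"
    proof
      fix z assume "z \<in> M"
      then have z: "z \<in> carrier G" "z \<otimes> (inv x \<otimes> u) \<in> U"
        by (auto simp: M_def)
      have "connected_component_of T (z \<otimes> inv x \<otimes> u) (z \<otimes> inv x \<otimes> x)"
        using ux z x by (intro connected_component_of_left_translation) auto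
      then have "connected_component_of T z (z \<otimes> (inv x \<otimes> u))"
        using x z u by (simp add: m_assoc connected_component_of_sym)
      then have "component_map T z = component_map T (z \<otimes> (inv x \<otimes> u))"
        using x z u by (subst component_map_eq_iff) (auto simp: topspace_eq)
      then show "z \<in> ?S"
        using z by (auto simp: topspace_eq)
    qed
    ultimately show "\<exists>M. openin T M \<and> x \<in> M \<and> M \<subseteq> ?S"
      by blast
  qed
  then show "openin (component_space T) (component_map T ` U)"
    using openin_subset[OF U] by (auto simp: openin_component_space)
qed

text \<open>Let \<open>x\<close> lie outside the component of \<open>y\<close>. If \<open>u\<close>
  near \<open>x\<close> and \<open>v\<close> near \<open>y\<close> shared a component, left
  translation by \<open>y \<otimes> inv v\<close> would put
  \<open>y \<otimes> (inv v \<otimes> u)\<close> into the component of \<open>y\<close>, which the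
  choice of \<open>W\<close> excludes. Openness of the component map then yields disjoint open
  images.\<close>

lemma Hausdorff_component_space: "Hausdorff_space (component_space T)"
  unfolding Hausdorff_space_def
proof (intro allI impI)
  fix C D assume "C \<in> topspace (component_space T) \<and> D \<in> topspace (component_space T) \<and> C \<noteq> D"
  then obtain x y where xy: "x \<in> carrier G" "y \<in> carrier G"
    and C: "C = component_map T x" and D: "D = component_map T y"
    by (auto simp: topspace_eq)
  then have ne: "\<not> connected_component_of T y x"
    using \<open>_ \<and> _ \<and> C \<noteq> D\<close> component_map_eq_iff[of y T x] by (simp add: topspace_eq)
  define W where "W = {z \<in> carrier G. y \<otimes> z \<in> topspace T - connected_component_of_set T y}"
  have W: "openin T W"
    unfolding W_def using xy closedin_connected_component_of
    by (intro openin_left_preimage openin_diff) auto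
  have "inv y \<otimes> x \<in> W"
    using xy ne by (simp add: W_def topspace_eq m_assoc[symmetric])
  then obtain V U where UV: "openin T V" "openin T U" "y \<in> V" "x \<in> U"
    "\<And>v u. v \<in> V \<Longrightarrow> u \<in> U \<Longrightarrow> inv v \<otimes> u \<in> W"
    using inv_mult_nhds[OF W _ xy(2,1)] by metis
  have "disjnt (component_map T ` U) (component_map T ` V)"
    unfolding disjnt_iff
  proof clarify
    fix u v assume uv: "u \<in> U" "v \<in> V" "component_map T u = component_map T v"
    have c: "u \<in> carrier G" "v \<in> carrier G"
      using uv openin_carrier[OF UV(1)] openin_carrier[OF UV(2)] by auto
    with uv have "connected_component_of T v u"
      by (metis component_map_eq_iff topspace_eq)
    then have "connected_component_of T (y \<otimes> inv v \<otimes> v) (y \<otimes> inv v \<otimes> u)"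
      using c xy by (intro connected_component_of_left_translation) auto
    then have "connected_component_of T y (y \<otimes> (inv v \<otimes> u))"
      using c xy by (simp add: m_assoc)
    then show False
      using UV(5)[OF uv(2,1)] by (simp add: W_def)
  qed
  then show "\<exists>U V. openin (component_space T) U \<and> openin (component_space T) V \<and>
      C \<in> U \<and> D \<in> V \<and> disjnt U V"
    using UV open_map_component_map unfolding C D open_map_def by blast
qed

text \<open>Open monotone surjections pull connected sets back to connected sets, so a connected set
  of components lies over a single component.\<close>

lemma connected_component_of_component_space:
  assumes "x \<in> topspace T"
  shows "connected_component_of_set (component_space T) (component_map T x) = {component_map T x}"
proof -
  have "D = component_map T x"
    if D: "connected_component_of (component_space T) (component_map T x) D" for D
  proof -
    obtain S where S: "connectedin (component_space T) S" "component_map T x \<in> S" "D \<in> S"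
      using D unfolding connected_component_of_def by blast
    have "connectedin T {z \<in> topspace T. component_map T z \<in> S}"
      using monotone_open_map[OF continuous_map_component_map open_map_component_map]
        monotone_map_component_map[of T] S(1) by auto
    moreover obtain d where d: "d \<in> topspace T" "D = component_map T d"
      using S connectedin_subset_topspace by fastforce
    ultimately have "connected_component_of T d x"
      using S assms unfolding connected_component_of_def by blast
    then show ?thesis
      using d assms by (simp add: component_map_eq_iff)
  qed
  moreover have "connected_component_of (component_space T) (component_map T x) (component_map T x)"
    using assms by (simp add: connected_component_of_refl)
  ultimately show ?thesis
    by blast
qed

text \<open>Components may fail to be compact, so compactness is exploited in the space of
  components. There a compact open set separates the identity component from another point; a
  tube-lemma argument makes the stabiliser of its preimage open, and the separated point makes it
  proper.\<close>

lemma connected_if_no_proper_open_subgroup: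
  assumes lc: "locally_compact_space T" and no: "no_proper_open_subgroup G T"
  shows "connected_space T"
proof (rule ccontr)
  assume "\<not> connected_space T"
  let ?Y = "component_space T" and ?p = "component_map T"
  obtain x where x: "x \<in> carrier G" "\<not> connected_component_of T \<one> x"
    using \<open>\<not> connected_space T\<close> topspace_eq
    by (metis connected_space_iff_connected_component connected_component_of_trans
        connected_component_of_sym)
  have lcY: "locally_compact_space ?Y"
    using locally_compact_space_continuous_open_map_image[OF continuous_map_component_map
        open_map_component_map _ lc] by simp
  have one: "?p \<one> \<in> topspace ?Y"
    by (simp add: topspace_eq)
  obtain M K where MK: "openin ?Y M" "compactin ?Y K" "?p \<one> \<in> M" "M \<subseteq> K"
    using lcY one unfolding locally_compact_space_def by metis
  have pne: "?p x \<noteq> ?p \<one>"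
    using x component_map_eq_iff[of \<one> T x] topspace_eq by auto
  \<comment> \<open>Removing \<open>?p x\<close> is what finally keeps \<open>x\<close> out of the
    stabiliser.\<close>
  have "openin ?Y (M - {?p x})"
    using MK(1) x Hausdorff_component_space
    by (intro openin_diff) (auto simp: topspace_eq intro: closedin_Hausdorff_singleton)
  moreover have "{?p \<one>} \<in> connected_components_of ?Y"
    using connected_component_of_component_space[of \<one>] one
    unfolding connected_components_of_def by (metis image_eqI one_closed topspace_eq)
  moreover have "compactin ?Y {?p \<one>}"
    using one by simp
  \<comment> \<open>In a locally compact Hausdorff space a compact component has arbitrarily small
    clopen neighbourhoods; here the component is the single point \<open>?p \<one>\<close>.\<close>
  ultimately obtain A B where AB: "openin ?Y A" "openin ?Y B" "disjnt A B" "A \<union> B = topspace ?Y"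
      "{?p \<one>} \<subseteq> A" "A \<subseteq> M - {?p x}"
    using wilder_locally_compact_component_thm[OF lcY Hausdorff_component_space] pne MK(3)
    by (metis Diff_iff empty_iff insert_subset insert_iff empty_subsetI)
  have "closedin ?Y A"
    using AB by (metis Diff_cancel Un_Diff Un_empty_right closedin_def disjnt_def Diff_triv
        inf_commute openin_subset Un_commute)
  then have compA: "compactin ?Y A"
    using MK AB by (meson Diff_subset closed_compactin subset_trans)
  define W where "W = {w \<in> carrier G. ?p w \<in> A}"
  \<comment> \<open>The two conditions together say \<open>g W = W\<close>, which makes closure
    under inverses immediate.\<close>
  define H where "H = {g \<in> carrier G. \<forall>w\<in>W. g \<otimes> w \<in> W \<and> inv g \<otimes> w \<in> W}"
  have W: "openin T W"
    using openin_continuous_map_preimage[OF continuous_map_component_map AB(1)]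
    by (simp add: W_def topspace_eq)
  have H: "subgroup H G"
  proof
    show "a \<otimes> b \<in> H" if "a \<in> H" "b \<in> H" for a b
      using that by (auto simp: H_def W_def m_assoc inv_mult_group)
  qed (auto simp: H_def W_def)
  have "\<exists>U V. openin T U \<and> openin T V \<and> \<one> \<in> V \<and> w \<in> U \<and> (\<forall>v\<in>V. \<forall>u\<in>U. v \<otimes> u \<in> W)"
    if "w \<in> W" for w
    using mult_nhds[OF W, of \<one> w] that
    by (metis (no_types, lifting) W_def l_one mem_Collect_eq one_closed)
  then obtain U V where UV: "\<And>w. w \<in> W \<Longrightarrow> openin T (U w) \<and> openin T (V w) \<and> \<one> \<in> V w \<and> w \<in> U w"
    and UVW: "\<And>w v u. w \<in> W \<Longrightarrow> v \<in> V w \<Longrightarrow> u \<in> U w \<Longrightarrow> v \<otimes> u \<in> W"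
    by metis
  have "A \<subseteq> (\<Union>w\<in>W. ?p ` U w)"
  proof
    fix a assume "a \<in> A"
    then obtain w where "w \<in> W" "a = ?p w"
      using openin_subset[OF AB(1)] by (auto simp: W_def topspace_eq)
    then show "a \<in> (\<Union>w\<in>W. ?p ` U w)"
      using UV by blast
  qed
  moreover have "openin ?Y (?p ` U w)" if "w \<in> W" for w
    using open_map_component_map UV[OF that] unfolding open_map_def by blast
  ultimately obtain F where F: "finite F" "F \<subseteq> W" "A \<subseteq> (\<Union>w\<in>F. ?p ` U w)"
    using compA unfolding compactin_def
    by (smt (verit) finite_subset_image imageE)
  define V' where "V' = topspace T \<inter> (\<Inter>w\<in>F. V w)"
  have "openin T V'"
    unfolding V'_def using F UV by (intro openin_Int_Inter) auto
  moreover have "\<one> \<in> V'"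
    unfolding V'_def using F UV by (auto simp: topspace_eq)
  ultimately have V': "openin T V'" "\<one> \<in> V'"
    by auto
  have V'W: "v \<otimes> w \<in> W" if "v \<in> V'" "w \<in> W" for v w
  proof -
    \<comment> \<open>The finite cover reaches only the component of \<open>w\<close>, so
      \<open>w\<close> is replaced by a point \<open>u\<close> of that component in some
      \<open>U z\<close>. This suffices because \<open>W\<close> is a union of components, which
      left translations permute.\<close>
    obtain z u where zu: "z \<in> F" "u \<in> U z" "?p w = ?p u"
      using F \<open>w \<in> W\<close> by (auto simp: W_def)
    have "openin T (U z)"
      using UV F zu(1) by blast
    then have c: "v \<in> carrier G" "w \<in> carrier G" "u \<in> carrier G"
      using that zu(2) openin_carrier[of V'] openin_carrier[of "U z"] V'(1) by (auto simp: W_def)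
    have "connected_component_of T w u"
      using zu c by (simp add: component_map_eq_iff topspace_eq)
    then have "connected_component_of T (v \<otimes> w) (v \<otimes> u)"
      using c by (intro connected_component_of_left_translation)
    then have "?p (v \<otimes> w) = ?p (v \<otimes> u)"
      using c by (simp add: component_map_eq_iff topspace_eq)
    moreover have "v \<otimes> u \<in> W"
      using zu F that by (intro UVW[of z]) (auto simp: V'_def)
    ultimately show ?thesis
      using c by (simp add: W_def)
  qed
  let ?V'' = "V' \<inter> {v \<in> carrier G. inv v \<in> V'}"
  have "openin T ?V''" "\<one> \<in> ?V''" "?V'' \<subseteq> H"
    using V' V'W inv_nhds by (auto simp: H_def)
  then have "openin T H"
    by (rule openin_subgroupI[OF H])
  then have "x \<in> H"
    using H no x by (auto simp: no_proper_open_subgroup_def)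
  moreover have "\<one> \<in> W"
    using AB by (simp add: W_def)
  ultimately have "x \<otimes> \<one> \<in> W"
    unfolding H_def by blast
  then show False
    using x AB by (auto simp: W_def)
qed

end


section \<open>Pseudocompactness\<close>

text \<open>Otherwise the sets \<open>W n\<close> are locally finite, and the sum of bump functions
  of height \<open>n\<close>, each vanishing outside \<open>W n\<close>, is continuous and
  unbounded.\<close>

lemma pseudocompact_accumulation_point:
  assumes X: "completely_regular_space X" "pseudocompact_space X"
    and W: "\<And>n::nat. openin X (W n)" "\<And>n. W n \<noteq> {}"
  obtains p where "p \<in> topspace X" "\<And>M. openin X M \<Longrightarrow> p \<in> M \<Longrightarrow> infinite {n. W n \<inter> M \<noteq> {}}"
proof (rule ccontr)
  assume "\<not> thesis"
  then have "\<forall>p\<in>topspace X. \<exists>M. openin X M \<and> p \<in> M \<and> finite {n. W n \<inter> M \<noteq> {}}"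
    using that by blast
  then obtain M where M: "\<And>p. p \<in> topspace X \<Longrightarrow> openin X (M p) \<and> p \<in> M p"
      "\<And>p. p \<in> topspace X \<Longrightarrow> finite {n. W n \<inter> M p \<noteq> {}}"
    by metis
  have "\<forall>n. \<exists>x. x \<in> W n"
    using W(2) by blast
  then obtain x where x: "\<And>n. x n \<in> W n"
    by metis
  have "\<exists>f. continuous_map X (top_of_set {0..1::real}) f \<and> f (x n) = 0 \<and> f ` (topspace X - W n) \<subseteq> {1}"
    for n
  proof -
    have "closedin X (topspace X - W n)"
      using W(1) by blast
    moreover have "x n \<in> topspace X - (topspace X - W n)"
      using x openin_subset[OF W(1)] by blast
    ultimately show ?thesis
      using X(1) unfolding completely_regular_space_def by blast
  qed
  then obtain f where f: "\<And>n. continuous_map X (top_of_set {0..1::real}) (f n)" "\<And>n. f n (x n) = 0"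
      "\<And>n. f n ` (topspace X - W n) \<subseteq> {1}"
    by metis
  define g where "g n y = real n * (1 - f n y)" for n y
  have gcont: "continuous_map X euclideanreal (g n)" for n
    unfolding g_def using f(1)[of n]
    by (intro continuous_intros) (auto simp: continuous_map_in_subtopology)
  have gnn: "0 \<le> g n y" if "y \<in> topspace X" for n y
    using that continuous_map_image_subset_topspace[OF f(1)[of n]] by (auto simp: g_def)
  have g0: "g n y = 0" if "y \<in> topspace X" "y \<notin> W n" for n y
    using that f(3)[of n] by (auto simp: g_def)
  \<comment> \<open>Local finiteness makes the index set finite, so the default value 0 of infinite
    sums never occurs.\<close>
  define h where "h y = (\<Sum>n | y \<in> W n. g n y)" for y
  have fin: "finite {n. y \<in> W n}" if "y \<in> topspace X" for y
    using M that by (metis (mono_tags, lifting) IntI empty_iff finite_subset mem_Collect_eq subsetI)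
  have heq: "h y = (\<Sum>n | W n \<inter> M p \<noteq> {}. g n y)" if "p \<in> topspace X" "y \<in> M p" for p y
    unfolding h_def
  proof (rule sum.mono_neutral_left)
    show "\<forall>i\<in>{n. W n \<inter> M p \<noteq> {}} - {n. y \<in> W n}. g i y = 0"
      using that M openin_subset g0 by (metis DiffD2 mem_Collect_eq subsetD)
  qed (use M that in auto)
  \<comment> \<open>On \<open>M p\<close> the index set can be enlarged to a finite one depending
    only on \<open>p\<close>, since the added terms vanish.\<close>
  have "continuous_map X euclideanreal h"
  proof (rule pasting_lemma[where I = "topspace X" and T = M and
        f = "\<lambda>p y. \<Sum>n | W n \<inter> M p \<noteq> {}. g n y"])
    show "continuous_map (subtopology X (M p)) euclideanreal (\<lambda>y. \<Sum>n | W n \<inter> M p \<noteq> {}. g n y)"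
      if "p \<in> topspace X" for p
      using M(2)[OF that] gcont by (intro continuous_map_sum continuous_map_from_subtopology) auto
  qed (use M heq in \<open>auto simp flip: heq\<close>)
  then have "bounded (h ` topspace X)"
    using X(2) unfolding pseudocompact_space_def by blast
  then obtain c where c: "\<And>y. y \<in> topspace X \<Longrightarrow> \<bar>h y\<bar> \<le> c"
    unfolding bounded_iff by auto
  obtain n where n: "real n > c"
    using reals_Archimedean2 by blast
  have xn: "x n \<in> topspace X"
    using x W(1) openin_subset by blast
  have "real n = g n (x n)"
    using f(2) by (simp add: g_def)
  also have "\<dots> \<le> h (x n)"
    unfolding h_def using fin[OF xn] x gnn[OF xn] by (intro member_le_sum) auto
  finally show False
    using c[OF xn] n by linarith
qed

text \<open>This is how pseudocompactness of a closed neighbourhood in \<open>D\<close> is seen from an ambient space \<open>X\<close>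
  in which \<open>D\<close> is dense: \<open>Q\<close> is open in \<open>X\<close>, but the accumulation point must lie in \<open>D\<close>.\<close>

definition accumulates_in :: "'a topology \<Rightarrow> 'a set \<Rightarrow> 'a set \<Rightarrow> bool" where
  "accumulates_in X D Q \<longleftrightarrow>
     (\<forall>Y::nat \<Rightarrow> 'a set. (\<forall>n. openin X (Y n) \<and> Y n \<noteq> {} \<and> Y n \<subseteq> Q) \<longrightarrow>
        (\<exists>y\<in>D. \<forall>M. openin X M \<and> y \<in> M \<longrightarrow> infinite {n. Y n \<inter> M \<noteq> {}}))"

section \<open>Accumulation points and disjoint closures\<close>

context topological_group
begin

text \<open>Right translation by \<open>d\<close> is a homeomorphism preserving \<open>D\<close>, so
  accumulation points stay in \<open>D\<close>. This carries an accumulating neighbourhood of the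
  identity to other points.\<close>

lemma accumulates_in_right_translation:
  assumes Q: "accumulates_in T D Q" and D: "subgroup D G" and d: "d \<in> D"
  shows "accumulates_in T D {x \<in> carrier G. x \<otimes> inv d \<in> Q}"
  unfolding accumulates_in_def
proof (intro allI impI)
  fix Y :: "nat \<Rightarrow> 'a set"
  assume Y: "\<forall>n. openin T (Y n) \<and> Y n \<noteq> {} \<and> Y n \<subseteq> {x \<in> carrier G. x \<otimes> inv d \<in> Q}"
  have dc: "d \<in> carrier G"
    using D d subgroup.mem_carrier by metis
  define Z where "Z n = {z \<in> carrier G. z \<otimes> d \<in> Y n}" for n
  have YZ: "y \<otimes> inv d \<in> Z n" if "y \<in> Y n" for y n
    using that Y dc by (fastforce simp: Z_def m_assoc)
  have "openin T (Z n) \<and> Z n \<noteq> {} \<and> Z n \<subseteq> Q" for n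
  proof (intro conjI)
    show "openin T (Z n)"
      unfolding Z_def using Y dc openin_right_preimage by blast
    show "Z n \<noteq> {}"
      using Y YZ by blast
    show "Z n \<subseteq> Q"
    proof
      fix z assume "z \<in> Z n"
      then have "z \<in> carrier G" "z \<otimes> d \<otimes> inv d \<in> Q"
        using Y by (auto simp: Z_def)
      then show "z \<in> Q"
        using dc by (simp add: m_assoc)
    qed
  qed
  then obtain y where y: "y \<in> D" "\<And>M. openin T M \<Longrightarrow> y \<in> M \<Longrightarrow> infinite {n. Z n \<inter> M \<noteq> {}}"
    using Q unfolding accumulates_in_def by metis
  have "infinite {n. Y n \<inter> M \<noteq> {}}" if M: "openin T M" "y \<otimes> d \<in> M" for M
  proof -
    have "infinite {n. Z n \<inter> {z \<in> carrier G. z \<otimes> d \<in> M} \<noteq> {}}"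
      using M y(1) D dc openin_right_preimage by (intro y(2)) (auto simp: subgroup.mem_carrier)
    then show ?thesis
      by (rule infinite_super[rotated]) (auto simp: Z_def)
  qed
  then show "\<exists>y\<in>D. \<forall>M. openin T M \<and> y \<in> M \<longrightarrow> infinite {n. Y n \<inter> M \<noteq> {}}"
    using y(1) d subgroup.m_closed[OF D] by blast
qed

lemma compact_nhd_base:
  assumes "locally_compact_space T" "openin T W" "\<one> \<in> W"
  obtains K U where "compactin T K" "openin T U" "\<one> \<in> U" "U \<subseteq> K" "K \<subseteq> W"
  using locally_compact_imp_neighbourhood_base[OF assms(1)
      locally_compact_Hausdorff_imp_regular_space[OF assms(1) Hausdorff]] assms(2,3)
  unfolding neighbourhood_base_of by metis

text \<open>The identity may have no countable neighbourhood base, so the neighbourhoods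
  \<open>K n\<close> shrink only to a compact set \<open>N\<close>, and each \<open>v n\<close> must
  be corrected by an element of \<open>N\<close>. The accumulation point of the \<open>Y n\<close>
  lies in \<open>D\<close>, hence in \<open>A\<close> or \<open>B\<close>; it avoids
  \<open>B\<close> because every \<open>Y n\<close> lies in \<open>A\<close>, and the corrected
  translations rule out \<open>A\<close>.\<close>

lemma disjoint_closures:
  assumes lc: "locally_compact_space T" and A: "openin T A" and B: "openin T B"
    and AB: "A \<inter> B = {}" and D: "D \<subseteq> A \<union> B"
    and Q: "openin T Q" "accumulates_in T D Q" and xQ: "x \<in> Q"
    and xA: "x \<in> T closure_of A" and xB: "x \<in> T closure_of B"
  shows False
proof -
  define nhd where "nhd K \<longleftrightarrow> compactin T K \<and> (\<exists>U. openin T U \<and> \<one> \<in> U \<and> U \<subseteq> K)" for K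
  \<comment> \<open>\<open>K'\<close> is the neighbourhood of the next stage: an element common to
    all stages can be divided off on the left with the result still in \<open>B\<close>.\<close>
  define step where "step K K' v Y \<longleftrightarrow> v \<in> K \<and> openin T Y \<and> Y \<noteq> {} \<and> Y \<subseteq> A \<inter> Q \<and>
      (\<forall>k\<in>K'. \<forall>y\<in>Y. inv k \<otimes> (v \<otimes> y) \<in> B)" for K K' v Y
  have xc: "x \<in> carrier G"
    using xQ Q openin_carrier by blast
  have "\<exists>K'. nhd K' \<and> K' \<subseteq> K \<and> (\<exists>v Y. step K K' v Y)" if K: "nhd K" for K
  proof -
    obtain U where U: "openin T U" "\<one> \<in> U" "U \<subseteq> K"
      using K unfolding nhd_def by blast
    \<comment> \<open>Points \<open>z\<close> of \<open>B\<close> and \<open>y\<close> of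
      \<open>A\<close> are taken so close to \<open>x\<close> that \<open>z \<otimes> inv y\<close>
      lies in \<open>U\<close>, hence in \<open>K\<close>; it carries \<open>y\<close> to
      \<open>z\<close>.\<close>
    obtain M M' where M: "openin T M" "openin T M'" "x \<in> M" "x \<in> M'"
        "\<And>z y. z \<in> M \<Longrightarrow> y \<in> M' \<Longrightarrow> z \<otimes> inv y \<in> U"
      using mult_inv_nhds[OF U(1) _ xc xc] xc U(2) by (metis r_inv)
    obtain z where z: "z \<in> B" "z \<in> M"
      using xB M unfolding in_closure_of by blast
    obtain y where y: "y \<in> A" "y \<in> M'" "y \<in> Q"
      using xA xQ openin_Int[OF M(2) Q(1)] M(4) unfolding in_closure_of by blast
    have c: "z \<in> carrier G" "y \<in> carrier G"
      using z y A B openin_carrier by blast+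
    let ?v = "z \<otimes> inv y"
    have "inv \<one> \<otimes> z \<in> B"
      using z c by simp
    then obtain V Z where VZ: "openin T V" "openin T Z" "\<one> \<in> V" "z \<in> Z"
        "\<And>k w. k \<in> V \<Longrightarrow> w \<in> Z \<Longrightarrow> inv k \<otimes> w \<in> B"
      using inv_mult_nhds[OF B _ one_closed c(1)] by metis
    obtain K' U' where K': "compactin T K'" "openin T U'" "\<one> \<in> U'" "U' \<subseteq> K'" "K' \<subseteq> U \<inter> V"
      using compact_nhd_base[OF lc openin_Int[OF U(1) VZ(1)]] U(2) VZ(3) by blast
    define Y where "Y = A \<inter> Q \<inter> {w \<in> carrier G. ?v \<otimes> w \<in> Z}"
    have "openin T Y"
      unfolding Y_def using A Q c VZ openin_left_preimage by auto
    moreover have "y \<in> Y"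
      using y c VZ by (simp add: Y_def m_assoc)
    moreover have "?v \<in> K"
      using M z y U by blast
    moreover have "inv k \<otimes> (?v \<otimes> w) \<in> B" if "k \<in> K'" "w \<in> Y" for k w
      using that VZ K' by (auto simp: Y_def)
    ultimately have "step K K' ?v Y"
      unfolding step_def Y_def by blast
    moreover have "nhd K'" "K' \<subseteq> K"
      using K' U by (auto simp: nhd_def)
    ultimately show ?thesis
      by blast
  qed
  moreover have "\<exists>K. nhd K"
    using compact_nhd_base[OF lc openin_topspace] one_closed unfolding nhd_def topspace_eq by metis
  ultimately obtain K where "\<And>n::nat. nhd (K n)" and Kdec: "\<And>n. K (Suc n) \<subseteq> K n"
      and "\<And>n. \<exists>v Y. step (K n) (K (Suc n)) v Y"
    using dependent_nat_choice[of "\<lambda>_. nhd" "\<lambda>_ K K'. K' \<subseteq> K \<and> (\<exists>v Y. step K K' v Y)"] by metis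
  then obtain v Y where K: "\<And>n. compactin T (K n)" and st: "\<And>n. step (K n) (K (Suc n)) (v n) (Y n)"
    unfolding nhd_def by metis
  have Kanti: "decseq K"
    using Kdec by (simp add: decseq_Suc_iff)
  have Kcl: "closedin T (K n)" for n
    using K Hausdorff by (rule compactin_imp_closedin[rotated])
  obtain y where y: "y \<in> D" "\<And>M. openin T M \<Longrightarrow> y \<in> M \<Longrightarrow> infinite {n. Y n \<inter> M \<noteq> {}}"
    using Q(2) st unfolding accumulates_in_def step_def by (metis Int_subset_iff)
  have "infinite {n. Y n \<inter> B \<noteq> {}}" if "y \<in> B"
    using y(2)[OF B that] .
  moreover have "Y n \<inter> B = {}" for n
    using st[of n] AB unfolding step_def by blast
  ultimately have yA: "y \<in> A"
    using D y(1) by auto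
  then have yc: "y \<in> carrier G"
    using A openin_carrier by blast
  obtain V M where VM: "openin T V" "openin T M" "\<one> \<in> V" "y \<in> M"
      "\<And>k w. k \<in> V \<Longrightarrow> w \<in> M \<Longrightarrow> k \<otimes> w \<in> A"
    using mult_nhds[OF A _ one_closed yc] yA yc by (metis l_one)
  define N where "N = (\<Inter>n. K n)"
  have Nc: "N \<subseteq> carrier G"
    using compactin_subset_topspace[OF K[of 0]] topspace_eq by (auto simp: N_def)
  have NV: "openin T (N <#> V)"
    using Nc VM(1) by (rule openin_set_mult)
  have NsubNV: "N \<subseteq> N <#> V"
    using Nc VM(3) unfolding set_mult_def by force
  \<comment> \<open>Nested compact sets whose intersection lies in an open set are eventually
    contained in it.\<close>
  have "\<exists>m. K m \<subseteq> N <#> V"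
  proof (rule ccontr)
    assume "\<nexists>m. K m \<subseteq> N <#> V"
    then have ne: "K n - (N <#> V) \<noteq> {}" for n
      by blast
    have "(\<Inter>n. K n - (N <#> V)) \<noteq> {}"
    proof (rule compact_space_imp_nest)
      show "compact_space (subtopology T (K 0))"
        using K compact_space_subtopology by blast
      show "closedin (subtopology T (K 0)) (K n - (N <#> V))" for n
        using Kcl NV Kanti by (intro closedin_subset_topspace closedin_diff) (auto simp: decseq_def)
      show "decseq (\<lambda>n. K n - (N <#> V))"
        using Kanti by (auto simp: decseq_def)
    qed (rule ne)
    then show False
      using NsubNV by (auto simp: N_def)
  qed
  then obtain m where m: "K m \<subseteq> N <#> V"
    by blast
  obtain n where n: "n \<ge> m" "Y n \<inter> M \<noteq> {}"
    using y(2)[OF VM(2,4)] by (metis (mono_tags, lifting) infinite_nat_iff_unbounded_le mem_Collect_eq)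
  then obtain w where w: "w \<in> Y n" "w \<in> M"
    by blast
  have "v n \<in> N <#> V"
    using st[of n] m n Kanti unfolding step_def decseq_def by blast
  then obtain u k where uk: "u \<in> N" "k \<in> V" "v n = u \<otimes> k"
    unfolding set_mult_def by blast
  have c: "u \<in> carrier G" "k \<in> carrier G" "w \<in> carrier G"
    using uk Nc w VM openin_carrier by blast+
  \<comment> \<open>Being in every neighbourhood, \<open>u\<close> lies in \<open>K (Suc n)\<close>,
    so stage \<open>n\<close> puts this element in \<open>B\<close>. It also equals
    \<open>k \<otimes> w\<close>, which is in \<open>A\<close> by the choice of \<open>V\<close> and
    \<open>M\<close>.\<close>
  have "inv u \<otimes> (v n \<otimes> w) \<in> B"
    using st[of n] uk(1) w(1) unfolding step_def N_def by blast
  moreover have "inv u \<otimes> (v n \<otimes> w) = k \<otimes> w"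
    using c uk by (simp add: m_assoc[symmetric])
  ultimately show False
    using VM(5)[OF uk(2) w(2)] AB by auto
qed

end

section \<open>Dense subgroups\<close>

context topological_group
begin

text \<open>The complement is a union of left cosets of \<open>H\<close>, each of them open.\<close>

lemma closedin_open_subgroup:
  assumes H: "subgroup H G" and "openin T H"
  shows "closedin T H"
proof -
  have sub: "H \<subseteq> carrier G"
    using H by (rule subgroup.subset)
  have "(carrier G - H) <#> H = carrier G - H"
  proof
    show "(carrier G - H) <#> H \<subseteq> carrier G - H"
    proof
      fix z assume "z \<in> (carrier G - H) <#> H"
      then obtain a h where ah: "a \<in> carrier G" "a \<notin> H" "h \<in> H" "z = a \<otimes> h"
        unfolding set_mult_def by blast
      have "h \<in> carrier G"
        using ah sub by blast
      then have "z \<otimes> inv h = a"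
        using ah by (simp add: m_assoc)
      then show "z \<in> carrier G - H"
        using ah \<open>h \<in> carrier G\<close> subgroup.m_closed[OF H] subgroup.m_inv_closed[OF H]
        by (metis Diff_iff m_closed)
    qed
    show "carrier G - H \<subseteq> (carrier G - H) <#> H"
      using subgroup.one_closed[OF H] unfolding set_mult_def by force
  qed
  then have "openin T (carrier G - H)"
    using openin_set_mult[OF _ assms(2), of "carrier G - H"] by simp
  then show ?thesis
    using sub by (simp add: closedin_def topspace_eq)
qed

lemma connected_imp_no_proper_open_subgroup:
  assumes "connected_space T"
  shows "no_proper_open_subgroup G T"
  using assms closedin_open_subgroup subgroup.one_closed
  unfolding no_proper_open_subgroup_def connected_space_clopen_in topspace_eq by fastforce

end

section \<open>A topological group densely embedded in another\<close>

locale dense_embedding = G: topological_group G T + K: topological_group K S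
  for G :: "('a, 'm) monoid_scheme" and T and K :: "('b, 'n) monoid_scheme" and S +
  fixes e :: "'a \<Rightarrow> 'b"
  assumes hom: "e \<in> hom G K"
    and embedding: "embedding_map T S e"
    and dense: "S closure_of (e ` carrier G) = carrier K"
begin

lemma group_hom: "group_hom G K e"
  using hom by (simp add: group_hom_def group_hom_axioms_def)

lemma subgroup_image: "subgroup (e ` carrier G) K"
  using group_hom.img_is_subgroup[OF group_hom] .

lemma inj: "inj_on e (carrier G)"
  using embedding G.topspace_eq unfolding embedding_map_def
  by (metis homeomorphic_imp_injective_map)

lemma continuous: "continuous_map T S e"
  using embedding unfolding embedding_map_def
  by (metis continuous_map_in_subtopology homeomorphic_imp_continuous_map)

lemma openin_preimage: "openin S U \<Longrightarrow> openin T {g \<in> carrier G. e g \<in> U}"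
  using openin_continuous_map_preimage[OF continuous] by (simp add: G.topspace_eq)

lemma image_openin:
  assumes "openin T U"
  obtains V where "openin S V" "e ` U = V \<inter> e ` carrier G"
proof -
  have "openin (subtopology S (e ` carrier G)) (e ` U)"
    using embedding assms G.topspace_eq homeomorphic_imp_open_map
    unfolding embedding_map_def open_map_def by metis
  then show thesis
    using that unfolding openin_subtopology by metis
qed

lemma meets_image:
  assumes "openin S U" "U \<noteq> {}"
  obtains g where "g \<in> carrier G" "e g \<in> U"
proof -
  obtain z where "z \<in> U"
    using assms by blast
  moreover have "z \<in> S closure_of (e ` carrier G)"
    using \<open>z \<in> U\<close> K.openin_carrier[OF assms(1)] dense by blast
  ultimately show thesis
    using that assms unfolding in_closure_of by blast
qed

lemma no_proper_open_subgroup_transfer: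
  assumes no: "no_proper_open_subgroup G T"
  shows "no_proper_open_subgroup K S"
  unfolding no_proper_open_subgroup_def
proof (intro allI impI)
  fix H assume H: "subgroup H K \<and> openin S H"
  interpret e: group_hom G K e
    by (rule group_hom)
  have "subgroup {g \<in> carrier G. e g \<in> H} G"
  proof
    show "inv\<^bsub>G\<^esub> a \<in> {g \<in> carrier G. e g \<in> H}" if "a \<in> {g \<in> carrier G. e g \<in> H}" for a
      using that H subgroup.m_inv_closed[of H K "e a"] by simp
  qed (use H in \<open>auto simp: subgroup.m_closed subgroup.one_closed\<close>)
  moreover have "openin T {g \<in> carrier G. e g \<in> H}"
    using H openin_preimage by blast
  ultimately have "{g \<in> carrier G. e g \<in> H} = carrier G"
    using no unfolding no_proper_open_subgroup_def by blast
  then have "e ` carrier G \<subseteq> H"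
    by blast
  then have "carrier K \<subseteq> H"
    using closure_of_minimal[OF _ K.closedin_open_subgroup] H dense by metis
  then show "H = carrier K"
    using H subgroup.subset by blast
qed

lemma closures_cover:
  assumes "e ` carrier G \<subseteq> A \<union> B"
  shows "topspace S \<subseteq> S closure_of A \<union> S closure_of B"
  using closure_of_mono[OF assms, of S] dense by (simp add: K.topspace_eq)

text \<open>By density the two nonempty closures cover the space, and a connected space is not the
  union of two disjoint nonempty closed sets.\<close>

lemma closures_meet:
  assumes "connected_space S" "e ` carrier G \<subseteq> A \<union> B"
    "A \<subseteq> carrier K" "B \<subseteq> carrier K" "A \<noteq> {}" "B \<noteq> {}"
  obtains x where "x \<in> S closure_of A" "x \<in> S closure_of B"
proof -
  have "S closure_of A \<noteq> {}" "S closure_of B \<noteq> {}"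
    using assms by (simp_all add: closure_of_eq_empty K.topspace_eq)
  then have "S closure_of A \<inter> S closure_of B \<noteq> {}"
    using assms(1) closures_cover[OF assms(2)] unfolding connected_space_closedin
    by (metis closedin_closure_of)
  then show thesis
    using that by blast
qed

text \<open>A common closure point of the images of \<open>H\<close> and its complement would have
  \<open>e h\<close> and \<open>e g\<close> near it, with \<open>h\<close> in \<open>H\<close> and
  \<open>g\<close> outside, so close that \<open>h\<close> and \<open>g\<close> lie in the same left
  coset of \<open>H\<close>.\<close>

lemma no_proper_open_subgroup_if_connected:
  assumes conn: "connected_space S"
  shows "no_proper_open_subgroup G T"
  unfolding no_proper_open_subgroup_def
proof (intro allI impI, rule ccontr)
  fix H assume H: "subgroup H G \<and> openin T H" and ne: "H \<noteq> carrier G"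
  interpret e: group_hom G K e
    by (rule group_hom)
  have sub: "H \<subseteq> carrier G"
    using H subgroup.subset by blast
  obtain V where V: "openin S V" "e ` H = V \<inter> e ` carrier G"
    using image_openin H by metis
  have one: "\<one>\<^bsub>G\<^esub> \<in> H"
    using H subgroup.one_closed by blast
  obtain x where x: "x \<in> S closure_of (e ` H)" "x \<in> S closure_of (e ` (carrier G - H))"
  proof (rule closures_meet[OF conn])
    show "e ` carrier G \<subseteq> e ` H \<union> e ` (carrier G - H)"
      by blast
    show "e ` H \<subseteq> carrier K" "e ` (carrier G - H) \<subseteq> carrier K"
      using sub by auto
    show "e ` H \<noteq> {}" "e ` (carrier G - H) \<noteq> {}"
      using one sub ne by auto
  qed
  have xc: "x \<in> carrier K"
    using x(1) in_closure_of K.topspace_eq by metis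
  have "inv\<^bsub>K\<^esub> x \<otimes>\<^bsub>K\<^esub> x \<in> V"
    using V(2) one xc e.hom_one by (metis IntD1 K.l_inv imageI)
  then obtain M M' where M: "openin S M" "openin S M'" "x \<in> M" "x \<in> M'"
      "\<And>u v. u \<in> M \<Longrightarrow> v \<in> M' \<Longrightarrow> inv\<^bsub>K\<^esub> u \<otimes>\<^bsub>K\<^esub> v \<in> V"
    using K.inv_mult_nhds[OF V(1) _ xc xc] by metis
  obtain h where h: "h \<in> H" "e h \<in> M"
    using x(1) M unfolding in_closure_of by blast
  obtain g where g: "g \<in> carrier G" "g \<notin> H" "e g \<in> M'"
    using x(2) M unfolding in_closure_of by blast
  have hc: "h \<in> carrier G"
    using h sub by blast
  have "e (inv\<^bsub>G\<^esub> h \<otimes>\<^bsub>G\<^esub> g) \<in> V"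
    using M(5)[OF h(2) g(3)] hc g by simp
  then have "e (inv\<^bsub>G\<^esub> h \<otimes>\<^bsub>G\<^esub> g) \<in> e ` H"
    unfolding V(2) using hc g by blast
  then have "inv\<^bsub>G\<^esub> h \<otimes>\<^bsub>G\<^esub> g \<in> H"
    using inj_on_image_mem_iff[OF inj _ sub] hc g(1) by (metis G.inv_closed G.m_closed)
  then have "h \<otimes>\<^bsub>G\<^esub> (inv\<^bsub>G\<^esub> h \<otimes>\<^bsub>G\<^esub> g) \<in> H"
    using H h subgroup.m_closed by metis
  then show False
    using g hc by (simp add: G.m_assoc[symmetric] del: e.hom_mult)
qed

text \<open>Density makes the preimages of the \<open>Y n\<close> nonempty. Their accumulation point
  is only known to lie in the closure of \<open>U\<close>, which is why
  \<open>accumulates_in\<close> asks for a point of \<open>D\<close> rather than of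
  \<open>Q\<close>.\<close>

lemma accumulates_in_if_pseudocompact:
  assumes U: "openin T U" and pc: "pseudocompact_space (subtopology T (T closure_of U))"
    and V: "e ` U = V \<inter> e ` carrier G"
  shows "accumulates_in S (e ` carrier G) V"
  unfolding accumulates_in_def
proof (intro allI impI)
  fix Y :: "nat \<Rightarrow> 'b set"
  assume Y: "\<forall>n. openin S (Y n) \<and> Y n \<noteq> {} \<and> Y n \<subseteq> V"
  let ?X = "subtopology T (T closure_of U)"
  define W where "W n = {g \<in> carrier G. e g \<in> Y n}" for n
  have Uc: "U \<subseteq> carrier G"
    using U by (rule G.openin_carrier)
  have WU: "W n \<subseteq> U" for n
  proof
    fix g assume "g \<in> W n"
    then have "g \<in> carrier G" "e g \<in> e ` U"
      using Y V by (auto simp: W_def)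
    then show "g \<in> U"
      using inj_on_image_mem_iff[OF inj _ Uc] by blast
  qed
  have "openin ?X (W n)" for n
  proof -
    have "openin T (W n)"
      unfolding W_def using Y openin_preimage by blast
    moreover have "U \<subseteq> T closure_of U"
      using Uc by (intro closure_of_subset) (simp add: G.topspace_eq)
    then have "W n = W n \<inter> T closure_of U"
      using WU by blast
    ultimately show ?thesis
      unfolding openin_subtopology by blast
  qed
  moreover have "W n \<noteq> {}" for n
    using Y meets_image[of "Y n"] unfolding W_def by blast
  moreover have "completely_regular_space ?X"
    using G.completely_regular by (rule completely_regular_space_subtopology)
  ultimately obtain p where p: "p \<in> topspace ?X"
      "\<And>M. openin ?X M \<Longrightarrow> p \<in> M \<Longrightarrow> infinite {n. W n \<inter> M \<noteq> {}}"
    using pseudocompact_accumulation_point[OF _ pc] by metis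
  have pU: "p \<in> carrier G" "p \<in> T closure_of U"
    using p(1) by (auto simp: G.topspace_eq)
  have "infinite {n. Y n \<inter> M \<noteq> {}}" if M: "openin S M" "e p \<in> M" for M
  proof -
    have "infinite {n. W n \<inter> ({g \<in> carrier G. e g \<in> M} \<inter> T closure_of U) \<noteq> {}}"
      using M pU openin_preimage by (intro p(2) openin_subtopology_Int) auto
    then show ?thesis
      by (rule infinite_super[rotated]) (auto simp: W_def)
  qed
  then show "\<exists>y\<in>e ` carrier G. \<forall>M. openin S M \<and> y \<in> M \<longrightarrow> infinite {n. Y n \<inter> M \<noteq> {}}"
    using pU by blast
qed

lemma connected_if_locally_pseudocompact:
  assumes lc: "locally_compact_space S" and conn: "connected_space S"
    and lpc: "locally_pseudocompact G T"
  shows "connected_space T"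
  unfolding connected_space_def
proof (intro notI, elim exE conjE)
  fix A' B' assume A': "openin T A'" "A' \<noteq> {}" and B': "openin T B'" "B' \<noteq> {}"
    and cover: "topspace T \<subseteq> A' \<union> B'" and dis: "A' \<inter> B' = {}"
  interpret e: group_hom G K e
    by (rule group_hom)
  have sub: "A' \<subseteq> carrier G" "B' \<subseteq> carrier G"
    using A' B' G.openin_carrier by blast+
  obtain A where A: "openin S A" "e ` A' = A \<inter> e ` carrier G"
    using image_openin[OF A'(1)] by metis
  obtain B where B: "openin S B" "e ` B' = B \<inter> e ` carrier G"
    using image_openin[OF B'(1)] by metis
  \<comment> \<open>By density a nonempty open intersection would contain a point
    \<open>e g\<close>, forcing \<open>g\<close> into both \<open>A'\<close> and
    \<open>B'\<close>.\<close>
  have AB: "A \<inter> B = {}"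
  proof (rule ccontr)
    assume "A \<inter> B \<noteq> {}"
    then obtain g where g: "g \<in> carrier G" "e g \<in> A \<inter> B"
      using meets_image[OF openin_Int[OF A(1) B(1)]] by metis
    then have "e g \<in> e ` A'" "e g \<in> e ` B'"
      unfolding A(2) B(2) by blast+
    then show False
      using inj_on_image_mem_iff[OF inj g(1) sub(1)] inj_on_image_mem_iff[OF inj g(1) sub(2)] dis
      by auto
  qed
  have D: "e ` carrier G \<subseteq> A \<union> B"
    using cover A(2) B(2) unfolding G.topspace_eq by blast
  obtain x where x: "x \<in> S closure_of A" "x \<in> S closure_of B"
  proof (rule closures_meet[OF conn D])
    show "A \<noteq> {}" "B \<noteq> {}"
      using A A' B B' by auto
  qed (use A B K.openin_carrier in auto)
  have xc: "x \<in> carrier K"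
    using x(1) in_closure_of K.topspace_eq by metis
  obtain U where U: "openin T U" "\<one>\<^bsub>G\<^esub> \<in> U" "pseudocompact_space (subtopology T (T closure_of U))"
    using lpc unfolding locally_pseudocompact_def identity_nhds_def by blast
  obtain V where V: "openin S V" "e ` U = V \<inter> e ` carrier G"
    using image_openin[OF U(1)] by metis
  have oneV: "\<one>\<^bsub>K\<^esub> \<in> V"
    using U(2) V(2) e.hom_one by (metis IntD1 imageI)
  \<comment> \<open>\<open>R\<close> consists of the \<open>z\<close> with
    \<open>x \<otimes> inv z\<close> in \<open>V\<close>. It is open and contains \<open>x\<close>,
    so density yields some \<open>e g\<close> in it, and then the right translate \<open>?Q\<close>
    of \<open>V\<close> by \<open>e g\<close> contains \<open>x\<close>.\<close>
  define R where "R = {z \<in> carrier K. inv\<^bsub>K\<^esub> z \<in> {w \<in> carrier K. x \<otimes>\<^bsub>K\<^esub> w \<in> V}}"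
  have "openin S R"
    unfolding R_def using xc V(1) by (intro K.inv_nhds K.openin_left_preimage)
  moreover have "x \<in> R"
    using xc oneV by (simp add: R_def)
  ultimately obtain g where g: "g \<in> carrier G" "e g \<in> R"
    using meets_image by blast
  let ?Q = "{z \<in> carrier K. z \<otimes>\<^bsub>K\<^esub> inv\<^bsub>K\<^esub> e g \<in> V}"
  show False
  proof (rule K.disjoint_closures[OF lc A(1) B(1) AB D _ _ _ x])
    show "openin S ?Q"
      using g V(1) by (intro K.openin_right_preimage) auto
    show "accumulates_in S (e ` carrier G) ?Q"
      using accumulates_in_if_pseudocompact[OF U(1,3) V(2)] subgroup_image g(1)
      by (intro K.accumulates_in_right_translation) auto
    show "x \<in> ?Q"
      using xc g by (simp add: R_def)
  qed
qed

end

theorem theorem4p6: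
  fixes G :: "('a, 'm) monoid_scheme" and T :: "'a topology"
    and Gt :: "('b, 'n) monoid_scheme" and Tt :: "'b topology"
    and e :: "'a \<Rightarrow> 'b"
  assumes "topological_group G T"
    and "locally_precompact G T"
    and "is_completion G T Gt Tt e"
  shows "(connected_space T \<longrightarrow> no_proper_open_subgroup G T)
    \<and> (no_proper_open_subgroup G T \<longleftrightarrow> connected_space Tt)
    \<and> (locally_pseudocompact G T \<longrightarrow>
         (connected_space T \<longleftrightarrow> no_proper_open_subgroup G T)
       \<and> (no_proper_open_subgroup G T \<longleftrightarrow> connected_space Tt))"
proof -
  have lc: "locally_compact_space Tt"
    using assms(3) by (simp add: is_completion_def)
  interpret dense_embedding G T Gt Tt e
    using assms by (simp add: dense_embedding_def dense_embedding_axioms_def is_completion_def)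
  have "connected_space T \<longrightarrow> no_proper_open_subgroup G T"
    using G.connected_imp_no_proper_open_subgroup by blast
  moreover have "no_proper_open_subgroup G T \<longleftrightarrow> connected_space Tt"
    using no_proper_open_subgroup_transfer K.connected_if_no_proper_open_subgroup[OF lc]
      no_proper_open_subgroup_if_connected by blast
  ultimately show ?thesis
    using connected_if_locally_pseudocompact[OF lc] by blast
qed

end
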